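(* Let $\rho_0,\rho_1\ge 0$ with $\rho_0+\rho_1<1$, let $\beta=1-\rho_0-\rho_1$, and let $\gamma\in(0,0.5)$. Let $(\mathbf{x}^1,y^1),\dots,(\mathbf{x}^T,y^T)$ be a sequence of examples with $\mathbf{x}^t\in\mathbb{R}^d$, $\|\mathbf{x}^t\|\le 1$ and $y^t\in[K]$ for all $t\in[T]$, presented to the algorithm RCNBF in $T$ trials. Let $W^*\in\mathbb{R}^{K\times d}$ be any matrix, let $R_H=\sum_{t=1}^T L_H(W^*,(\mathbf{x}^t,y^t))$ be its cumulative hinge loss and let $D=\|W^*\|_F^2=\sum_{r=1}^K\sum_{j=1}^d (W^*_{r,j})^2$. Then the expected number of mistakes $M=\sum_{t=1}^T\mathbb{I}[\tilde y^t\ne y^t]$ made by RCNBF satisfies $$\mathbb{E}[M]\le R_H+\sqrt{A_1 D R_H}+3\max\left\{A_1 D,\sqrt{A_2 D T}\right\}+\gamma T,$$ where $$A_1=\frac{2K}{\gamma}+\frac{2\rho_0(1-\rho_0)K}{\beta\gamma}+\frac{K\rho_1}{\beta^2\gamma}+\frac{\rho_0(1-\rho_0)K^2}{\beta^2\gamma^2},\qquad A_2=2\gamma+\frac{\rho_1}{\beta^2(1-\gamma)}+\frac{\rho_0(1-\rho_0)K^2}{\beta^2\gamma},$$ and the expectation is over all the randomness of the algorithm (the sampled labels and the feedback noise).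
   Context: Notation: $[K]=\{1,\dots,K\}$ with $K\ge 2$; $\mathbb{I}[A]$ is $1$ if $A$ holds and $0$ otherwise; $[a]_+=\max(0,a)$; $\|\cdot\|$ is the Euclidean norm. For $W\in\mathbb{R}^{K\times d}$ with rows $\mathbf{w}_1,\dots,\mathbf{w}_K$, the multiclass hinge loss is $L_H(W,(\mathbf{x},y))=\max_{j\ne y}[1-\mathbf{w}_y\cdot\mathbf{x}+\mathbf{w}_j\cdot\mathbf{x}]_+$. Algorithm RCNBF with parameters $\gamma,\rho_0,\rho_1$: start with $W^1=0\in\mathbb{R}^{K\times d}$. At trial $t=1,\dots,T$: receive $\mathbf{x}^t$; set $\hat y^t=\arg\max_{r\in[K]}\mathbf{w}^t_r\cdot\mathbf{x}^t$ (ties broken by a fixed rule); set $P^t(r)=(1-\gamma)\mathbb{I}[r=\hat y^t]+\gamma/K$ for $r\in[K]$; sample $\tilde y^t\sim P^t$ (fresh randomness, given the past) and predict $\tilde y^t$. The true feedback is $f^t=\mathbb{I}[\tilde y^t=y^t]$, but the learner receives noisy feedback $f_\rho^t\in\{0,1\}$ whose law, given $\tilde y^t$ and the past, satisfies $P(f_\rho^t=1\mid f^t=0)=\rho_0$ and $P(f_\rho^t=0\mid f^t=1)=\rho_1$. Define $h(1)=\frac{1-\rho_0}{1-\rho_0-\rho_1}$, $h(0)=\frac{-\rho_0}{1-\rho_0-\rho_1}$. Update $W^{t+1}=W^t+H^t$, where $H^t_{r,j}=x^t_j\left(\frac{h(f_\rho^t)\,\mathbb{I}[\tilde y^t=r]}{P^t(r)}-\mathbb{I}[\hat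 y^t=r]\right)$. *)

theory Defs
  imports "HOL-Probability.Probability"
begin

text \<open>
  Labels are the elements of a finite type \<open>'k\<close>, instances are vectors indexed by a finite
  type \<open>'d\<close>, and a weight matrix has type \<open>real ^ 'd ^ 'k\<close>, so that \<open>W $ r\<close> is its row
  for label \<open>r\<close>.
\<close>

definition hinge_loss :: "real ^ 'd ^ 'k \<Rightarrow> real ^ 'd \<Rightarrow> 'k \<Rightarrow> real" where
  "hinge_loss W x y = (MAX j \<in> {j. j \<noteq> y}. max 0 (1 - W $ y \<bullet> x + W $ j \<bullet> x))"

definition is_argmax_rule :: "(('k \<Rightarrow> real) \<Rightarrow> 'k) \<Rightarrow> bool" where
  "is_argmax_rule am \<longleftrightarrow> (\<forall>s. is_arg_max s (\<lambda>_. True) (am s))"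

definition explore_prob :: "real \<Rightarrow> 'k::finite \<Rightarrow> 'k \<Rightarrow> real" where
  "explore_prob \<gamma> yhat r = (1 - \<gamma>) * of_bool (r = yhat) + \<gamma> / real CARD('k)"

text \<open>
  \<open>embed_pmf\<close> is meaningful only for a nonnegative function of total mass one; see
  \<open>pmf_label_pmf\<close> below.
\<close>

definition label_pmf :: "real \<Rightarrow> 'k::finite \<Rightarrow> 'k pmf" where
  "label_pmf \<gamma> yhat = embed_pmf (explore_prob \<gamma> yhat)"

lemma pmf_label_pmf:
  fixes yhat :: "'k::finite"
  assumes "0 \<le> \<gamma>" "\<gamma> \<le> 1"
  shows "pmf (label_pmf \<gamma> yhat) r = explore_prob \<gamma> yhat r"
proof -
  have nn: "0 \<le> explore_prob \<gamma> yhat r" for r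
    using assms by (simp add: explore_prob_def)
  have "(\<Sum>r\<in>UNIV. explore_prob \<gamma> yhat r) = 1"
    by (simp add: explore_prob_def sum.distrib flip: sum_distrib_left)
  then have "(\<integral>\<^sup>+ r. ennreal (explore_prob \<gamma> yhat r) \<partial>count_space UNIV) = 1"
    using nn by (simp add: nn_integral_count_space_finite)
  then show ?thesis
    unfolding label_pmf_def using nn by (intro pmf_embed_pmf)
qed

text \<open>
  The law of the noisy feedback given the true feedback. Only rates in the unit interval are
  meaningful, since \<open>bernoulli_pmf\<close> truncates its parameter.
\<close>

definition noisy_feedback_pmf :: "real \<Rightarrow> real \<Rightarrow> bool \<Rightarrow> bool pmf" where
  "noisy_feedback_pmf \<rho>0 \<rho>1 f = bernoulli_pmf (if f then 1 - \<rho>1 else \<rho>0)"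

definition feedback_est :: "real \<Rightarrow> real \<Rightarrow> bool \<Rightarrow> real" where
  "feedback_est \<rho>0 \<rho>1 f =
     (if f then (1 - \<rho>0) / (1 - \<rho>0 - \<rho>1) else (- \<rho>0) / (1 - \<rho>0 - \<rho>1))"

definition update_matrix ::
  "real \<Rightarrow> real \<Rightarrow> real \<Rightarrow> real ^ 'd \<Rightarrow> 'k::finite \<Rightarrow> 'k \<Rightarrow> bool \<Rightarrow> real ^ 'd ^ 'k" where
  "update_matrix \<gamma> \<rho>0 \<rho>1 x yhat ytil f\<rho> =
     (\<chi> r j. x $ j * (feedback_est \<rho>0 \<rho>1 f\<rho> * of_bool (ytil = r) / explore_prob \<gamma> yhat r
                      - of_bool (yhat = r)))"

text \<open>
  The joint law, after \<open>n\<close> trials, of the current matrix (the one used in trial \<open>n + 1\<close>) and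
  of the labels predicted in trials \<open>1, \<dots>, n\<close>. The latter are recorded as a function whose
  values at other arguments are irrelevant.
\<close>

primrec rcnbf ::
  "real \<Rightarrow> real \<Rightarrow> real \<Rightarrow> (('k::finite \<Rightarrow> real) \<Rightarrow> 'k) \<Rightarrow> (nat \<Rightarrow> real ^ 'd) \<Rightarrow> (nat \<Rightarrow> 'k) \<Rightarrow> nat
     \<Rightarrow> ((real ^ 'd ^ 'k) \<times> (nat \<Rightarrow> 'k)) pmf" where
  "rcnbf \<gamma> \<rho>0 \<rho>1 am x y 0 = return_pmf (0, \<lambda>_. undefined)"
| "rcnbf \<gamma> \<rho>0 \<rho>1 am x y (Suc n) =
     do {
       (W, p) \<leftarrow> rcnbf \<gamma> \<rho>0 \<rho>1 am x y n;
       let t = Suc n;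
       let yhat = am (\<lambda>r. W $ r \<bullet> x t);
       ytil \<leftarrow> label_pmf \<gamma> yhat;
       f\<rho> \<leftarrow> noisy_feedback_pmf \<rho>0 \<rho>1 (ytil = y t);
       return_pmf (W + update_matrix \<gamma> \<rho>0 \<rho>1 (x t) yhat ytil f\<rho>, p(t := ytil))
     }"

definition mistakes :: "nat \<Rightarrow> (nat \<Rightarrow> 'k) \<Rightarrow> (nat \<Rightarrow> 'k) \<Rightarrow> real" where
  "mistakes T y p = (\<Sum>t = 1..T. of_bool (p t \<noteq> y t))"

end

theory Submission imports Defs begin

text \<open>
  The noisy feedback estimate is unbiased, so in expectation the update in each trial is the
  multiclass perceptron update. Let \<open>m\<close> be the expected number of trials whose greedy label is
  wrong. The update makes \<open>E (Wstar \<bullet> W)\<close> grow at least like \<open>m - RH\<close>, while \<open>E (W \<bullet> W)\<close> is at most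
  \<open>A1 * m + A2 * T\<close> because the cross term is nonpositive for the greedy label. By Cauchy--Schwarz
  \<open>m - RH \<le> sqrt (D * (A1 * m + A2 * T))\<close>, and solving this quadratic inequality bounds \<open>m\<close>.
  Exploration adds at most \<open>\<gamma>\<close> expected mistakes per trial.
\<close>

section \<open>Finite expectations and the split into single trials\<close>

lemma expectation_bind_pmf_finite:
  fixes h :: "'b \<Rightarrow> real"
  assumes "finite (set_pmf p)" and "\<And>a. finite (set_pmf (f a))"
  shows "measure_pmf.expectation (bind_pmf p f) h
         = measure_pmf.expectation p (\<lambda>a. measure_pmf.expectation (f a) h)"
  using pmf_expectation_bind[of "set_pmf p" f p h] assms
  by (simp add: integral_measure_pmf_real[of "set_pmf p"] mult.commute)

text \<open>A trial depends on the past only through the greedy label, so its fresh randomness is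
  isolated as a joint law of sampled label and noisy feedback.\<close>

definition trial_pmf ::
  "real \<Rightarrow> real \<Rightarrow> real \<Rightarrow> 'k::finite \<Rightarrow> 'k \<Rightarrow> ('k \<times> bool) pmf" where
  "trial_pmf \<gamma> \<rho>0 \<rho>1 yhat y =
     label_pmf \<gamma> yhat \<bind> (\<lambda>r. map_pmf (Pair r) (noisy_feedback_pmf \<rho>0 \<rho>1 (r = y)))"

lemma finite_set_trial_pmf [simp]: "finite (set_pmf (trial_pmf \<gamma> \<rho>0 \<rho>1 yhat y))"
  by (rule finite)

lemma rcnbf_Suc_trial:
  "rcnbf \<gamma> \<rho>0 \<rho>1 am x y (Suc n) =
     rcnbf \<gamma> \<rho>0 \<rho>1 am x y n \<bind> (\<lambda>(W, p).
       let yhat = am (\<lambda>r. W $ r \<bullet> x (Suc n)) in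
       map_pmf (\<lambda>(r, b). (W + update_matrix \<gamma> \<rho>0 \<rho>1 (x (Suc n)) yhat r b, p(Suc n := r)))
         (trial_pmf \<gamma> \<rho>0 \<rho>1 yhat (y (Suc n))))"
  by (auto intro!: bind_pmf_cong
      simp: trial_pmf_def Let_def map_bind_pmf bind_map_pmf map_pmf_def bind_assoc_pmf
        bind_return_pmf split: prod.splits)

lemma finite_set_rcnbf [simp]: "finite (set_pmf (rcnbf \<gamma> \<rho>0 \<rho>1 am x y n))"
  by (induction n) (auto simp: rcnbf_Suc_trial Let_def simp del: rcnbf.simps(2))

text \<open>The tower rule: conditioning on the first \<open>n\<close> trials fixes
  \<open>W\<close>, and with it \<open>yhat\<close>, which leaves an expectation over one trial
  only.\<close>

lemma expectation_rcnbf_Suc: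
  fixes F :: "(real ^ 'd ^ 'k::finite) \<times> (nat \<Rightarrow> 'k) \<Rightarrow> real"
  shows "measure_pmf.expectation (rcnbf \<gamma> \<rho>0 \<rho>1 am x y (Suc n)) F =
    measure_pmf.expectation (rcnbf \<gamma> \<rho>0 \<rho>1 am x y n) (\<lambda>(W, p).
       let yhat = am (\<lambda>r. W $ r \<bullet> x (Suc n)) in
       measure_pmf.expectation (trial_pmf \<gamma> \<rho>0 \<rho>1 yhat (y (Suc n)))
         (\<lambda>(r, b). F (W + update_matrix \<gamma> \<rho>0 \<rho>1 (x (Suc n)) yhat r b, p(Suc n := r))))"
  unfolding rcnbf_Suc_trial
  by (subst expectation_bind_pmf_finite)
     (auto simp: Let_def split_beta intro!: Bochner_Integration.integral_cong)

section \<open>Moments of the feedback estimate and of one update\<close>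

lemma explore_prob_pos:
  assumes "0 < \<gamma>" "\<gamma> < 1"
  shows "0 < explore_prob \<gamma> yhat r"
  using assms by (auto simp: explore_prob_def intro!: add_nonneg_pos)

lemma sum_explore_prob: "(\<Sum>r\<in>UNIV. explore_prob \<gamma> yhat r) = 1"
  by (simp add: explore_prob_def sum.distrib flip: sum_distrib_left)

lemma expectation_trial:
  fixes g :: "'k::finite \<times> bool \<Rightarrow> real"
  assumes "0 < \<gamma>" "\<gamma> < 1" "0 \<le> \<rho>0" "0 \<le> \<rho>1" "\<rho>0 + \<rho>1 < 1"
  shows "measure_pmf.expectation (trial_pmf \<gamma> \<rho>0 \<rho>1 yhat y) g =
    (\<Sum>r\<in>UNIV. explore_prob \<gamma> yhat r *
       ((if r = y then 1 - \<rho>1 else \<rho>0) * g (r, True)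
        + (1 - (if r = y then 1 - \<rho>1 else \<rho>0)) * g (r, False)))"
  unfolding trial_pmf_def
  using assms
  by (subst expectation_bind_pmf_finite)
     (auto simp: noisy_feedback_pmf_def integral_measure_pmf_real[of UNIV] pmf_label_pmf UNIV_bool
       mult.commute intro!: sum.cong)

text \<open>The two values of \<open>feedback_est\<close> solve the 2-by-2 linear system that
  inverts the noise channel, so the estimate is unbiased for the true feedback.\<close>

lemma feedback_est_mean:
  assumes "\<rho>0 + \<rho>1 < 1"
  shows "(if c then 1 - \<rho>1 else \<rho>0) * feedback_est \<rho>0 \<rho>1 True
    + (1 - (if c then 1 - \<rho>1 else \<rho>0)) * feedback_est \<rho>0 \<rho>1 False = of_bool c"
  using assms by (auto simp: feedback_est_def divide_simps) (simp_all add: algebra_simps)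

text \<open>The two values differ by \<open>1 / (1 - \<rho>0 - \<rho>1)\<close>, so the variance is
  a Bernoulli variance over \<open>(1 - \<rho>0 - \<rho>1)\<^sup>2\<close>; the squared mean, 1 or
  0, is added to it.\<close>

lemma feedback_est_second_moment:
  assumes "\<rho>0 + \<rho>1 < 1"
  shows "(if c then 1 - \<rho>1 else \<rho>0) * (feedback_est \<rho>0 \<rho>1 True)\<^sup>2
    + (1 - (if c then 1 - \<rho>1 else \<rho>0)) * (feedback_est \<rho>0 \<rho>1 False)\<^sup>2
    = (if c then 1 + \<rho>1 * (1 - \<rho>1) / (1 - \<rho>0 - \<rho>1)\<^sup>2 else \<rho>0 * (1 - \<rho>0) / (1 - \<rho>0 - \<rho>1)\<^sup>2)"
  using assms by (auto simp: feedback_est_def divide_simps) (simp_all add: algebra_simps power2_eq_square)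

lemma update_matrix_row:
  "update_matrix \<gamma> \<rho>0 \<rho>1 x yhat r b $ s =
     (feedback_est \<rho>0 \<rho>1 b * of_bool (r = s) / explore_prob \<gamma> yhat s - of_bool (yhat = s)) *\<^sub>R x"
  by (simp add: update_matrix_def vec_eq_iff mult.commute)

lemma inner_update_matrix:
  "V \<bullet> update_matrix \<gamma> \<rho>0 \<rho>1 x yhat r b =
     feedback_est \<rho>0 \<rho>1 b / explore_prob \<gamma> yhat r * (V $ r \<bullet> x) - V $ yhat \<bullet> x"
proof -
  have "V \<bullet> update_matrix \<gamma> \<rho>0 \<rho>1 x yhat r b =
      (\<Sum>s\<in>UNIV. (if r = s then feedback_est \<rho>0 \<rho>1 b / explore_prob \<gamma> yhat s * (V $ s \<bullet> x) else 0)
        - (if yhat = s then V $ s \<bullet> x else 0))"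
    unfolding inner_vec_def[of V] update_matrix_row
    by (intro sum.cong) (auto simp: algebra_simps)
  then show ?thesis
    by (simp add: sum_subtractf)
qed

lemma inner_update_matrix_self:
  "update_matrix \<gamma> \<rho>0 \<rho>1 x yhat r b \<bullet> update_matrix \<gamma> \<rho>0 \<rho>1 x yhat r b =
     ((feedback_est \<rho>0 \<rho>1 b / explore_prob \<gamma> yhat r)\<^sup>2
      - 2 * of_bool (r = yhat) * (feedback_est \<rho>0 \<rho>1 b / explore_prob \<gamma> yhat r) + 1) * (x \<bullet> x)"
  unfolding inner_update_matrix update_matrix_row
  by (auto simp: algebra_simps power2_eq_square)

text \<open>Importance weighting: drawing label \<open>r\<close> with probability
  \<open>explore_prob \<gamma> yhat r\<close> cancels the division by it, and the unbiased estimate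
  then selects the row of \<open>y\<close>.\<close>

lemma expectation_inner_update:
  fixes V :: "real ^ 'd ^ 'k::finite"
  assumes "0 < \<gamma>" "\<gamma> < 1" "0 \<le> \<rho>0" "0 \<le> \<rho>1" "\<rho>0 + \<rho>1 < 1"
  shows "measure_pmf.expectation (trial_pmf \<gamma> \<rho>0 \<rho>1 yhat y)
      (\<lambda>(r, b). V \<bullet> update_matrix \<gamma> \<rho>0 \<rho>1 x yhat r b) = V $ y \<bullet> x - V $ yhat \<bullet> x"
proof -
  let ?P = "explore_prob \<gamma> yhat" and ?q = "\<lambda>r. if r = y then 1 - \<rho>1 else \<rho>0"
  let ?h = "feedback_est \<rho>0 \<rho>1"
  have P0: "?P r \<noteq> 0" for r
    using explore_prob_pos[OF assms(1,2), of yhat r] by simp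
  have "measure_pmf.expectation (trial_pmf \<gamma> \<rho>0 \<rho>1 yhat y)
      (\<lambda>(r, b). V \<bullet> update_matrix \<gamma> \<rho>0 \<rho>1 x yhat r b)
    = (\<Sum>r\<in>UNIV. (?q r * ?h True + (1 - ?q r) * ?h False) * (V $ r \<bullet> x) - ?P r * (V $ yhat \<bullet> x))"
    unfolding expectation_trial[OF assms] inner_update_matrix prod.case
    by (intro sum.cong refl) (use P0 in \<open>simp add: divide_simps\<close>, simp add: algebra_simps)
  also have "\<dots> = (\<Sum>r\<in>UNIV. (if r = y then V $ r \<bullet> x else 0)) - V $ yhat \<bullet> x"
    unfolding feedback_est_mean[OF assms(5)]
    by (simp add: sum_subtractf sum_explore_prob flip: sum_distrib_right)
  finally show ?thesis by simp
qed

text \<open>Squared weights keep one factor \<open>1 / explore_prob\<close> and the second moment of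
  the estimate. In the cross term the probability cancels, and the mean survives only if
  \<open>yhat = y\<close>. The final 1 comes from the greedy row.\<close>

lemma expectation_update_sq:
  fixes x :: "real ^ 'd" and y :: "'k::finite"
  assumes "0 < \<gamma>" "\<gamma> < 1" "0 \<le> \<rho>0" "0 \<le> \<rho>1" "\<rho>0 + \<rho>1 < 1"
  defines "\<beta> \<equiv> 1 - \<rho>0 - \<rho>1"
  shows "measure_pmf.expectation (trial_pmf \<gamma> \<rho>0 \<rho>1 yhat y)
      (\<lambda>(r, b). update_matrix \<gamma> \<rho>0 \<rho>1 x yhat r b \<bullet> update_matrix \<gamma> \<rho>0 \<rho>1 x yhat r b)
    = ((\<Sum>r\<in>UNIV. (if r = y then 1 + \<rho>1 * (1 - \<rho>1) / \<beta>\<^sup>2 else \<rho>0 * (1 - \<rho>0) / \<beta>\<^sup>2)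
                   / explore_prob \<gamma> yhat r) - 2 * of_bool (yhat = y) + 1) * (x \<bullet> x)"
proof -
  let ?P = "explore_prob \<gamma> yhat" and ?q = "\<lambda>r. if r = y then 1 - \<rho>1 else \<rho>0"
  let ?h = "feedback_est \<rho>0 \<rho>1"
  have P0: "?P r \<noteq> 0" for r
    using explore_prob_pos[OF assms(1,2), of yhat r] by simp
  \<comment> \<open>Here \<open>q\<close> is the probability of feedback \<open>True\<close>,
    \<open>h\<close> and \<open>k\<close> are the estimates at \<open>True\<close> and
    \<open>False\<close>, and \<open>i\<close> indicates the greedy label; the right side is grouped
    by moments.\<close>
  have alg: "P * (q * (((h / P)\<^sup>2 - 2 * i * (h / P) + 1) * z)
        + (1 - q) * (((k / P)\<^sup>2 - 2 * i * (k / P) + 1) * z))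
      = ((q * h\<^sup>2 + (1 - q) * k\<^sup>2) / P - 2 * i * (q * h + (1 - q) * k) + P) * z"
    if "P \<noteq> 0" for P q h k i z :: real
    using that by (simp add: divide_simps power2_eq_square) (simp add: algebra_simps)
  have "measure_pmf.expectation (trial_pmf \<gamma> \<rho>0 \<rho>1 yhat y)
      (\<lambda>(r, b). update_matrix \<gamma> \<rho>0 \<rho>1 x yhat r b \<bullet> update_matrix \<gamma> \<rho>0 \<rho>1 x yhat r b)
    = (\<Sum>r\<in>UNIV. ((?q r * (?h True)\<^sup>2 + (1 - ?q r) * (?h False)\<^sup>2) / ?P r
        - 2 * of_bool (r = yhat) * (?q r * ?h True + (1 - ?q r) * ?h False) + ?P r) * (x \<bullet> x))"
    unfolding expectation_trial[OF assms(1-5)] inner_update_matrix_self prod.case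
    by (intro sum.cong refl alg P0)
  also have "\<dots> = (\<Sum>r\<in>UNIV. ((if r = y then 1 + \<rho>1 * (1 - \<rho>1) / \<beta>\<^sup>2 else \<rho>0 * (1 - \<rho>0) / \<beta>\<^sup>2) / ?P r
        - (if r = yhat then 2 * of_bool (yhat = y) else 0) + ?P r) * (x \<bullet> x))"
    unfolding feedback_est_mean[OF assms(5)] feedback_est_second_moment[OF assms(5)] \<beta>_def
    by (intro sum.cong) auto
  finally show ?thesis
    by (simp add: sum_subtractf sum.distrib sum_explore_prob flip: sum_distrib_right)
qed

text \<open>A correct greedy label is abandoned only by exploration, with probability below
  \<open>\<gamma>\<close>; a wrong one is charged in full.\<close>

lemma expectation_trial_mistake:
  fixes y :: "'k::finite"
  assumes "0 < \<gamma>" "\<gamma> < 1" "0 \<le> \<rho>0" "0 \<le> \<rho>1" "\<rho>0 + \<rho>1 < 1"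
  shows "measure_pmf.expectation (trial_pmf \<gamma> \<rho>0 \<rho>1 yhat y) (\<lambda>(r, b). of_bool (r \<noteq> y))
    \<le> of_bool (yhat \<noteq> y) + \<gamma>"
proof -
  have "measure_pmf.expectation (trial_pmf \<gamma> \<rho>0 \<rho>1 yhat y) (\<lambda>(r, b). of_bool (r \<noteq> y))
    = (\<Sum>r\<in>UNIV. explore_prob \<gamma> yhat r - (if r = y then explore_prob \<gamma> yhat r else 0))"
    unfolding expectation_trial[OF assms] by (intro sum.cong) (auto simp: algebra_simps)
  also have "\<dots> = 1 - explore_prob \<gamma> yhat y"
    by (simp add: sum_subtractf sum_explore_prob)
  also have "\<dots> \<le> of_bool (yhat \<noteq> y) + \<gamma>"
  proof -
    have "0 \<le> \<gamma> / real CARD('k)" using assms by simp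
    then have "- (\<gamma> / real CARD('k)) \<le> \<gamma>" using assms by linarith
    then show ?thesis using assms by (auto simp: explore_prob_def)
  qed
  finally show ?thesis .
qed

section \<open>Hinge-loss margin, a quadratic inequality, and the size of one update\<close>

lemma hinge_loss_ge:
  assumes "j \<noteq> y"
  shows "max 0 (1 - W $ y \<bullet> x + W $ j \<bullet> x) \<le> hinge_loss W x (y :: 'k::finite)"
  unfolding hinge_loss_def using assms by (intro Max_ge) auto

text \<open>A wrong \<open>yhat\<close> is one of the competitors in the maximum. For
  \<open>yhat = y\<close> the claim is nonnegativity of the loss, where a second label makes the
  maximum range over a nonempty set.\<close>

lemma hinge_loss_margin:
  fixes y :: "'k::finite"
  assumes "CARD('k) \<ge> 2"
  shows "of_bool (yhat \<noteq> y) - hinge_loss W x y \<le> W $ y \<bullet> x - W $ yhat \<bullet> x"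
proof (cases "yhat = y")
  case True
  have "\<exists>j. j \<noteq> y"
  proof (rule ccontr)
    assume "\<nexists>j. j \<noteq> y"
    then have "(UNIV :: 'k set) = {y}" by auto
    then have "CARD('k) = 1" by (metis card_1_singleton_iff One_nat_def)
    then show False using assms by simp
  qed
  then obtain j where "j \<noteq> y" by blast
  from hinge_loss_ge[OF this, of W x] True show ?thesis by simp
next
  case False
  from hinge_loss_ge[OF this, of W x] False show ?thesis by simp
qed

text \<open>With \<open>u = m - R\<close> the quadratic premise becomes
  \<open>u * (u - a) \<le> a * R + b\<^sup>2\<close>. It is assumed only for
  \<open>R \<le> m\<close>, the case in which a bound on \<open>m - R\<close> may be
  squared.\<close>

lemma quadratic_regret_bound:
  fixes a b m R :: real
  assumes "0 \<le> a" "0 \<le> b" "0 \<le> R" "R \<le> m \<Longrightarrow> (m - R)\<^sup>2 \<le> a * m + b\<^sup>2"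
  shows "m \<le> R + sqrt (a * R) + 3 * max a b"
proof (rule ccontr)
  define u s c where "u = m - R" and "s = sqrt (a * R)" and "c = max a b"
  assume "\<not> ?thesis"
  then have u: "u > s + 3 * c" by (simp add: u_def s_def c_def)
  have s: "0 \<le> s" "s\<^sup>2 = a * R" using assms by (auto simp: s_def)
  have c: "0 \<le> c" "a \<le> c" "b \<le> c" using assms by (auto simp: c_def)
  have "b\<^sup>2 \<le> c\<^sup>2" using c assms by (intro power_mono)
  \<comment> \<open>As \<open>a \<le> c\<close>, the negated goal also gives
    \<open>u - a > s + 2 * c\<close>; the product then exceeds \<open>s\<^sup>2 + c\<^sup>2\<close>,
    contradicting the premise.\<close>
  have "(s + 3 * c) * (s + 2 * c) < u * (u - a)"
    using u s c by (intro mult_strict_mono') auto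
  moreover have "s\<^sup>2 + c\<^sup>2 \<le> (s + 3 * c) * (s + 2 * c)"
    using s c by (simp add: algebra_simps power2_eq_square)
  moreover have "u * (u - a) \<le> a * R + b\<^sup>2"
    using assms(4) u s c by (simp add: u_def algebra_simps power2_eq_square)
  ultimately show False using s \<open>b\<^sup>2 \<le> c\<^sup>2\<close> by linarith
qed

text \<open>With a correct greedy label, the terms -2 and 1 offset the leading part of
  \<open>1 / explore_prob\<close>, leaving noise and an excess of order \<open>\<gamma>\<close>,
  paid by \<open>A2\<close>. With a wrong one, \<open>y\<close> is sampled with probability only
  \<open>\<gamma> / K\<close>, and the resulting \<open>K / \<gamma>\<close> is charged to
  \<open>A1\<close>.\<close>

lemma expectation_update_sq_le:
  fixes x :: "real ^ 'd" and y :: "'k::finite" and \<beta> \<gamma> \<rho>0 \<rho>1 K A1 A2 :: real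
  assumes "0 < \<gamma>" "\<gamma> < 1 / 2" "0 \<le> \<rho>0" "0 \<le> \<rho>1" "\<rho>0 + \<rho>1 < 1" "norm x \<le> 1"
    and \<beta>: "\<beta> = 1 - \<rho>0 - \<rho>1" and K: "K = real CARD('k)"
    and A1: "A1 = 2 * K / \<gamma> + 2 * \<rho>0 * (1 - \<rho>0) * K / (\<beta> * \<gamma>)
              + K * \<rho>1 / (\<beta>\<^sup>2 * \<gamma>) + \<rho>0 * (1 - \<rho>0) * K\<^sup>2 / (\<beta>\<^sup>2 * \<gamma>\<^sup>2)"
    and A2: "A2 = 2 * \<gamma> + \<rho>1 / (\<beta>\<^sup>2 * (1 - \<gamma>)) + \<rho>0 * (1 - \<rho>0) * K\<^sup>2 / (\<beta>\<^sup>2 * \<gamma>)"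
  shows "measure_pmf.expectation (trial_pmf \<gamma> \<rho>0 \<rho>1 yhat y)
      (\<lambda>(r, b). update_matrix \<gamma> \<rho>0 \<rho>1 x yhat r b \<bullet> update_matrix \<gamma> \<rho>0 \<rho>1 x yhat r b)
    \<le> A1 * of_bool (yhat \<noteq> y) + A2"
proof -
  let ?P = "explore_prob \<gamma> yhat"
  \<comment> \<open>\<open>v0\<close> and \<open>v1\<close> are the variances of the estimate at a
    wrong and at the correct label; \<open>w\<close> bounds \<open>v1\<close> and has the form in
    which \<open>\<rho>1\<close> enters \<open>A1\<close> and \<open>A2\<close>.\<close>
  define v0 v1 w where "v0 = \<rho>0 * (1 - \<rho>0) / \<beta>\<^sup>2" and "v1 = \<rho>1 * (1 - \<rho>1) / \<beta>\<^sup>2"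
    and "w = \<rho>1 / \<beta>\<^sup>2"
  have \<gamma>1: "\<gamma> < 1" and \<beta>0: "\<beta> > 0" using assms by auto
  have K1: "1 \<le> K" unfolding K by (simp add: Suc_leI)
  have v: "0 \<le> v0" "0 \<le> v1" "v1 \<le> w" "0 \<le> w"
    using assms by (auto simp: v0_def v1_def w_def intro!: divide_right_mono mult_left_le)
  have P: "0 < ?P r" "\<gamma> / K \<le> ?P r" for r
    using explore_prob_pos[OF assms(1) \<gamma>1, of yhat r] \<gamma>1 by (auto simp: explore_prob_def K)
  have v0P: "v0 / ?P r \<le> v0 * (K / \<gamma>)" for r
  proof -
    have "1 / ?P r \<le> 1 / (\<gamma> / K)"
      using P[of r] assms K1 by (intro divide_left_mono) auto
    then show ?thesis using mult_left_mono[OF _ v(1)] by fastforce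
  qed
  \<comment> \<open>The noise cost \<open>v0 * (K / \<gamma>)\<close> is granted to all
    \<open>K\<close> labels, including \<open>y\<close>, which produces the \<open>K\<^sup>2\<close>
    term.\<close>
  have "(\<Sum>r\<in>UNIV. (if r = y then 1 + v1 else v0) / ?P r)
      \<le> (\<Sum>r\<in>UNIV. (if r = y then (1 + v1) / ?P r else 0) + v0 * (K / \<gamma>))"
    using v0P v assms K1 by (intro sum_mono) auto
  also have "\<dots> = (1 + v1) / ?P y + v0 * K\<^sup>2 / \<gamma>"
    by (simp add: sum.distrib K power2_eq_square)
  finally have S: "(\<Sum>r\<in>UNIV. (if r = y then 1 + v1 else v0) / ?P r)
      \<le> (1 + v1) / ?P y + v0 * K\<^sup>2 / \<gamma>" .
  have A2': "A2 = 2 * \<gamma> + w / (1 - \<gamma>) + v0 * K\<^sup>2 / \<gamma>"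
    using A2 by (simp add: w_def v0_def)
  have A2_nonneg: "0 \<le> A2"
    unfolding A2' using v assms K1 by (intro add_nonneg_nonneg) auto
  have A1_ge: "2 * K / \<gamma> + w * K / \<gamma> \<le> A1"
  proof -
    have "0 \<le> 2 * \<rho>0 * (1 - \<rho>0) * K / (\<beta> * \<gamma>)" "0 \<le> \<rho>0 * (1 - \<rho>0) * K\<^sup>2 / (\<beta>\<^sup>2 * \<gamma>\<^sup>2)"
      using assms \<beta>0 K1 by auto
    then show ?thesis unfolding A1 w_def by (simp add: mult.commute)
  qed
  have A1_nonneg: "0 \<le> A1"
    using A1_ge v K1 assms(1) by (intro order_trans[OF _ A1_ge] add_nonneg_nonneg) auto
  have coeff: "(1 + v1) / ?P y + v0 * K\<^sup>2 / \<gamma> - 2 * of_bool (yhat = y) + 1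
      \<le> A1 * of_bool (yhat \<noteq> y) + A2"
  proof (cases "yhat = y")
    case True
    have Py: "1 - \<gamma> \<le> ?P y" using True assms by (simp add: explore_prob_def)
    have "(1 + v1) / ?P y \<le> (1 + w) / (1 - \<gamma>)"
      using v Py \<gamma>1 by (intro frac_le) auto
    \<comment> \<open>Clearing the denominator leaves
      \<open>2 * \<gamma>\<^sup>2 \<le> \<gamma>\<close>; this is where
      \<open>\<gamma> < 1 / 2\<close> enters.\<close>
    moreover have "1 / (1 - \<gamma>) \<le> 1 + 2 * \<gamma>"
      using assms(1,2) by (simp add: divide_simps) (simp add: algebra_simps)
    ultimately show ?thesis using True by (simp add: A2' add_divide_distrib)
  next
    case False
    then have Py: "?P y = \<gamma> / K" by (simp add: explore_prob_def K)
    have "(1 + v1) / ?P y \<le> K / \<gamma> + w * K / \<gamma>"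
      unfolding Py using v K1 assms(1) mult_right_mono[of "v1" "w" "K / \<gamma>"]
      by (simp add: distrib_right add_divide_distrib)
    \<comment> \<open>Of the two copies of \<open>K / \<gamma>\<close> in \<open>A1\<close>, one
      pays for the sampled row and the other absorbs the 1 from the greedy row.\<close>
    moreover have "1 \<le> K / \<gamma>" using K1 assms(1) \<gamma>1 by (simp add: divide_simps)
    moreover have "v0 * K\<^sup>2 / \<gamma> \<le> A2"
      unfolding A2' using v assms(1) \<gamma>1 by simp
    ultimately show ?thesis using False A1_ge by simp
  qed
  have "x \<bullet> x \<le> 1" using \<open>norm x \<le> 1\<close> by (simp add: dot_square_norm power_le_one)
  have "measure_pmf.expectation (trial_pmf \<gamma> \<rho>0 \<rho>1 yhat y)
      (\<lambda>(r, b). update_matrix \<gamma> \<rho>0 \<rho>1 x yhat r b \<bullet> update_matrix \<gamma> \<rho>0 \<rho>1 x yhat r b)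
    = ((\<Sum>r\<in>UNIV. (if r = y then 1 + v1 else v0) / ?P r) - 2 * of_bool (yhat = y) + 1) * (x \<bullet> x)"
    unfolding expectation_update_sq[OF assms(1) \<gamma>1 assms(3-5)] v0_def v1_def \<beta> ..
  also have "\<dots> \<le> (A1 * of_bool (yhat \<noteq> y) + A2) * (x \<bullet> x)"
    using S coeff by (intro mult_right_mono) auto
  also have "\<dots> \<le> A1 * of_bool (yhat \<noteq> y) + A2"
    using A1_nonneg A2_nonneg \<open>x \<bullet> x \<le> 1\<close> by (intro mult_left_le) auto
  finally show ?thesis .
qed

section \<open>Accumulating one-trial bounds by potential functions\<close>

definition greedy_error ::
  "real \<Rightarrow> real \<Rightarrow> real \<Rightarrow> (('k::finite \<Rightarrow> real) \<Rightarrow> 'k) \<Rightarrow> (nat \<Rightarrow> real ^ 'd) \<Rightarrow> (nat \<Rightarrow> 'k) \<Rightarrow> nat \<Rightarrow> real" where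
  "greedy_error \<gamma> \<rho>0 \<rho>1 am x y n = (\<Sum>t<n. measure_pmf.expectation (rcnbf \<gamma> \<rho>0 \<rho>1 am x y t)
     (\<lambda>(W, p). of_bool (am (\<lambda>r. W $ r \<bullet> x (Suc t)) \<noteq> y (Suc t))))"

text \<open>Conditional increments of a potential telescope. Its three uses take
  \<open>mistakes\<close>, \<open>- (Wstar \<bullet> W)\<close> and \<open>W \<bullet> W\<close> as
  potential. Greedy errors enter as a sum of expectations because the history records sampled labels
  only; the state after \<open>t\<close> trials meets example \<open>Suc t\<close>.\<close>

lemma rcnbf_drift:
  fixes F :: "nat \<Rightarrow> real ^ 'd ^ 'k::finite \<Rightarrow> (nat \<Rightarrow> 'k) \<Rightarrow> real"
  assumes step: "\<And>t W p yhat. t < T \<Longrightarrow> yhat = am (\<lambda>r. W $ r \<bullet> x (Suc t)) \<Longrightarrow>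
     measure_pmf.expectation (trial_pmf \<gamma> \<rho>0 \<rho>1 yhat (y (Suc t)))
       (\<lambda>(r, b). F (Suc t) (W + update_matrix \<gamma> \<rho>0 \<rho>1 (x (Suc t)) yhat r b) (p(Suc t := r)))
     \<le> F t W p + c * of_bool (yhat \<noteq> y (Suc t)) + d (Suc t)"
  shows "measure_pmf.expectation (rcnbf \<gamma> \<rho>0 \<rho>1 am x y T) (\<lambda>(W, p). F T W p)
    \<le> F 0 0 (\<lambda>_. undefined) + c * greedy_error \<gamma> \<rho>0 \<rho>1 am x y T + (\<Sum>t = 1..T. d t)"
  using step
proof (induction T)
  case 0
  then show ?case by (simp add: greedy_error_def)
next
  case (Suc n)
  let ?M = "rcnbf \<gamma> \<rho>0 \<rho>1 am x y n"
  let ?e = "\<lambda>W. of_bool (am (\<lambda>r. W $ r \<bullet> x (Suc n)) \<noteq> y (Suc n)) :: real"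
  have int: "integrable (measure_pmf ?M) g" for g :: "_ \<Rightarrow> real"
    by (rule integrable_measure_pmf_finite) simp
  have "measure_pmf.expectation (rcnbf \<gamma> \<rho>0 \<rho>1 am x y (Suc n)) (\<lambda>(W, p). F (Suc n) W p)
    \<le> measure_pmf.expectation ?M (\<lambda>(W, p). F n W p + c * ?e W + d (Suc n))"
    unfolding expectation_rcnbf_Suc Let_def prod.case
    by (intro integral_mono int) (clarify, rule Suc.prems, simp_all)
  also have "\<dots> = measure_pmf.expectation ?M (\<lambda>(W, p). F n W p)
      + c * measure_pmf.expectation ?M (\<lambda>(W, p). ?e W) + d (Suc n)"
    by (simp add: case_prod_unfold int)
  also have "measure_pmf.expectation ?M (\<lambda>(W, p). F n W p)
      \<le> F 0 0 (\<lambda>_. undefined) + c * greedy_error \<gamma> \<rho>0 \<rho>1 am x y n + (\<Sum>t = 1..n. d t)"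
    using Suc.prems by (intro Suc.IH) auto
  finally show ?case
    by (simp add: greedy_error_def algebra_simps)
qed

lemma integrable_trial_pmf [simp]:
  "integrable (measure_pmf (trial_pmf \<gamma> \<rho>0 \<rho>1 yhat y)) (f :: _ \<Rightarrow> real)"
  by (rule integrable_measure_pmf_finite) simp

theorem theorem4:
  fixes \<rho>0 \<rho>1 \<beta> \<gamma> K RH D A1 A2 :: real
    and T :: nat
    and x :: "nat \<Rightarrow> real ^ 'd"
    and y :: "nat \<Rightarrow> 'k::finite"
    and am :: "('k \<Rightarrow> real) \<Rightarrow> 'k"
    and Wstar :: "real ^ 'd ^ 'k"
  assumes "CARD('k) \<ge> 2"
    and "K = real CARD('k)"
    and "\<rho>0 \<ge> 0" and "\<rho>1 \<ge> 0" and "\<rho>0 + \<rho>1 < 1"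
    and "\<beta> = 1 - \<rho>0 - \<rho>1"
    and "0 < \<gamma>" and "\<gamma> < 1 / 2"
    and "\<And>t. t \<in> {1..T} \<Longrightarrow> norm (x t) \<le> 1"
    and "is_argmax_rule am"
    and "RH = (\<Sum>t = 1..T. hinge_loss Wstar (x t) (y t))"
    and "D = (\<Sum>r\<in>UNIV. \<Sum>j\<in>UNIV. (Wstar $ r $ j)\<^sup>2)"
    and "A1 = 2 * K / \<gamma> + 2 * \<rho>0 * (1 - \<rho>0) * K / (\<beta> * \<gamma>)
              + K * \<rho>1 / (\<beta>\<^sup>2 * \<gamma>) + \<rho>0 * (1 - \<rho>0) * K\<^sup>2 / (\<beta>\<^sup>2 * \<gamma>\<^sup>2)"
    and "A2 = 2 * \<gamma> + \<rho>1 / (\<beta>\<^sup>2 * (1 - \<gamma>)) + \<rho>0 * (1 - \<rho>0) * K\<^sup>2 / (\<beta>\<^sup>2 * \<gamma>)"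
  shows "measure_pmf.expectation (rcnbf \<gamma> \<rho>0 \<rho>1 am x y T) (\<lambda>(W, p). mistakes T y p)
         \<le> RH + sqrt (A1 * D * RH) + 3 * max (A1 * D) (sqrt (A2 * D * real T)) + \<gamma> * real T"
proof -
  have \<gamma>1: "\<gamma> < 1" using assms by simp
  note rates = assms(7) \<gamma>1 assms(3-5)
  define M where "M = rcnbf \<gamma> \<rho>0 \<rho>1 am x y T"
  define m where "m = greedy_error \<gamma> \<rho>0 \<rho>1 am x y T"
  have int: "integrable (measure_pmf M) g" for g :: "_ \<Rightarrow> real"
    by (rule integrable_measure_pmf_finite) (simp add: M_def)
  have greedy: "W $ r \<bullet> x t \<le> W $ am (\<lambda>r. W $ r \<bullet> x t) \<bullet> x t" for W :: "real ^ 'd ^ 'k" and r t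
    using assms(10)[unfolded is_argmax_rule_def is_arg_max_linorder, rule_format, of "\<lambda>r. W $ r \<bullet> x t"]
    by simp
  have K1: "0 < K" using assms(1,2) by simp
  have \<beta>0: "0 < \<beta>" using assms by simp
  have A_nonneg: "0 \<le> A1" "0 \<le> A2"
    unfolding assms(13,14) using assms(3-5,7,8) K1 \<beta>0 by (auto intro!: add_nonneg_nonneg)
  have D: "D = Wstar \<bullet> Wstar"
    unfolding assms(12) by (simp add: inner_vec_def power2_eq_square)
  have RH_nonneg: "0 \<le> RH"
  proof -
    \<comment> \<open>Taking \<open>yhat = y t\<close> makes the margin zero.\<close>
    have "0 \<le> hinge_loss Wstar (x t) (y t)" for t
      using hinge_loss_margin[OF assms(1), of "y t" "y t" Wstar "x t"] by simp
    then show ?thesis unfolding assms(11) by (intro sum_nonneg) auto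
  qed

  have mist: "measure_pmf.expectation M (\<lambda>(W, p). mistakes T y p) \<le> m + \<gamma> * real T"
  proof -
    have "measure_pmf.expectation (rcnbf \<gamma> \<rho>0 \<rho>1 am x y T) (\<lambda>(W, p). mistakes T y p)
      \<le> mistakes 0 y (\<lambda>_. undefined) + 1 * greedy_error \<gamma> \<rho>0 \<rho>1 am x y T + (\<Sum>t = 1..T. \<gamma>)"
    proof (rule rcnbf_drift[where F = "\<lambda>t W p. mistakes t y p"], goal_cases)
      case (1 t W p yhat)
      have "mistakes (Suc t) y (p(Suc t := r)) = mistakes t y p + of_bool (r \<noteq> y (Suc t))" for r
        by (auto simp: mistakes_def intro!: sum.cong)
      then show ?case
        using expectation_trial_mistake[OF rates, of yhat "y (Suc t)"]
        by (simp add: case_prod_unfold)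
    qed
    then show ?thesis by (simp add: M_def m_def mistakes_def mult.commute)
  qed

  have lower: "m - RH \<le> measure_pmf.expectation M (\<lambda>(W, p). Wstar \<bullet> W)"
  proof -
    \<comment> \<open>The drift lemma bounds from above, so the lower bound is obtained by negating
      the potential, with \<open>c = -1\<close> and the hinge losses as \<open>d\<close>.\<close>
    have "measure_pmf.expectation (rcnbf \<gamma> \<rho>0 \<rho>1 am x y T) (\<lambda>(W, p). - (Wstar \<bullet> W))
      \<le> - (Wstar \<bullet> 0) + (- 1) * greedy_error \<gamma> \<rho>0 \<rho>1 am x y T
        + (\<Sum>t = 1..T. hinge_loss Wstar (x t) (y t))"
    proof (rule rcnbf_drift[where F = "\<lambda>t W p. - (Wstar \<bullet> W)"], goal_cases)
      case (1 t W p yhat)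
      show ?case
        using hinge_loss_margin[OF assms(1), of yhat "y (Suc t)" Wstar "x (Suc t)"]
          expectation_inner_update[OF rates, of yhat "y (Suc t)" Wstar "x (Suc t)"]
        by (simp add: inner_add_right case_prod_unfold)
    qed
    then show ?thesis by (simp add: M_def m_def assms(11) case_prod_unfold)
  qed

  have upper: "measure_pmf.expectation M (\<lambda>(W, p). W \<bullet> W) \<le> A1 * m + A2 * real T"
  proof -
    have "measure_pmf.expectation (rcnbf \<gamma> \<rho>0 \<rho>1 am x y T) (\<lambda>(W, p). W \<bullet> W)
      \<le> 0 \<bullet> (0 :: real ^ 'd ^ 'k) + A1 * greedy_error \<gamma> \<rho>0 \<rho>1 am x y T + (\<Sum>t = 1..T. A2)"
    proof (rule rcnbf_drift[where F = "\<lambda>t W p. W \<bullet> W"], goal_cases)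
      case (1 t W p yhat)
      let ?H = "\<lambda>z. update_matrix \<gamma> \<rho>0 \<rho>1 (x (Suc t)) yhat (fst z) (snd z)"
      have sq: "(W + ?H z) \<bullet> (W + ?H z) = W \<bullet> W + (2 * (W \<bullet> ?H z) + ?H z \<bullet> ?H z)" for z
        by (simp add: inner_add_left inner_add_right inner_commute)
      have "norm (x (Suc t)) \<le> 1" using 1 assms(9) by auto
      \<comment> \<open>The cross term has mean \<open>2 * (W $ y (Suc t) \<bullet> x (Suc t) - W $
        yhat \<bullet> x (Suc t))\<close>, which is nonpositive because \<open>yhat\<close>
        maximises the score.\<close>
      from expectation_update_sq_le[OF assms(7,8,3-5) this assms(6,2,13,14), of yhat "y (Suc t)"]
        expectation_inner_update[OF rates, of yhat "y (Suc t)" W "x (Suc t)"]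
        greedy[of W "y (Suc t)" "Suc t"]
      show ?case
        unfolding case_prod_unfold sq by (simp add: 1(2))
    qed
    then show ?thesis by (simp add: M_def m_def mult.commute)
  qed

  have "(m - RH)\<^sup>2 \<le> A1 * D * m + (sqrt (A2 * D * real T))\<^sup>2" if "RH \<le> m"
  proof -
    let ?Z = "\<lambda>(W, p). Wstar \<bullet> W :: real"
    have "(m - RH)\<^sup>2 \<le> (measure_pmf.expectation M ?Z)\<^sup>2"
      using that lower by (intro power_mono) auto
    \<comment> \<open>Jensen's inequality for the square, in the form of a nonnegative variance;
      Cauchy--Schwarz is then applied pointwise.\<close>
    also have "\<dots> \<le> measure_pmf.expectation M (\<lambda>z. (?Z z)\<^sup>2)"
      using measure_pmf.variance_eq[OF int int, of ?Z] measure_pmf.variance_positive[of M ?Z]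
      by simp
    also have "\<dots> \<le> measure_pmf.expectation M (\<lambda>(W, p). D * (W \<bullet> W))"
      by (intro integral_mono int) (auto simp: D Cauchy_Schwarz_ineq)
    also have "\<dots> = D * measure_pmf.expectation M (\<lambda>(W, p). W \<bullet> W)"
      by (simp add: case_prod_unfold)
    also have "\<dots> \<le> D * (A1 * m + A2 * real T)"
      using upper by (intro mult_left_mono) (auto simp: D)
    finally show ?thesis
      using A_nonneg by (simp add: D algebra_simps)
  qed
  \<comment> \<open>The scalar inequality with \<open>a = A1 * D\<close> and
    \<open>b = sqrt (A2 * D * real T)\<close>.\<close>
  then have "m \<le> RH + sqrt (A1 * D * RH) + 3 * max (A1 * D) (sqrt (A2 * D * real T))"
    using A_nonneg RH_nonneg by (intro quadratic_regret_bound) (auto simp: D)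
  with mist show ?thesis by (simp add: M_def)
qed

end
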